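(* If $k$ is a positive integer, then $\omega^\omega\to_{cl}(\omega^2,k)^2$.
   Context: All arithmetic operations on ordinals are in the ordinal sense. Every ordinal is identified with the set of smaller ordinals and carries the order topology; subsets carry the subspace topology. A set $X$ of ordinals is order-homeomorphic to an ordinal $\alpha$ (a closed copy of $\alpha$) if there is a bijection $X\to\alpha$ that is both an order-isomorphism and a homeomorphism; equivalently, $X$ is order-isomorphic to $\alpha$ and closed in its supremum. $[X]^2$ is the set of $2$-element subsets of $X$. $\beta\to_{cl}(\alpha,k)^2$ means: for every coloring $c:[\beta]^2\to\{\text{red},\text{blue}\}$ either there is $X\subseteq\beta$ order-homeomorphic to $\alpha$ with all elements of $[X]^2$ red, or there is a $k$-element $Y\subseteq\beta$ with all elements of $[Y]^2$ blue. *)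

theory Defs
  imports "HOL-Analysis.Analysis" "HOL-Library.Ramsey"
begin

text \<open>
  An ordinal is represented by a (reflexive) well-order relation \<open>r\<close> of that order type; the set
  of smaller ordinals is then \<open>Field r\<close>. In particular \<open>natLeq\<close> represents \<open>\<omega>\<close> and
  \<open>natLeq_on n\<close> represents the finite ordinal \<open>n\<close>.
\<close>

text \<open>
  Ordinal exponentiation \<open>r^s\<close>: functions from \<open>s\<close> to \<open>r\<close> that take a nonzero value (one that has
  strict predecessors in \<open>r\<close>) only finitely often, compared at the largest argument where they
  differ. Such an \<open>f\<close> stands for the sum of the terms \<open>r^x * f x\<close>, taken with \<open>x\<close> decreasing
  (Cantor normal form to base \<open>r\<close>).
\<close>

definition ord_exp_carrier :: "'a rel \<Rightarrow> 'b rel \<Rightarrow> ('b \<Rightarrow> 'a) set" where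
  "ord_exp_carrier r s =
     {f \<in> Field s \<rightarrow>\<^sub>E Field r. finite {x \<in> Field s. underS r (f x) \<noteq> {}}}"

definition ord_exp :: "'a rel \<Rightarrow> 'b rel \<Rightarrow> ('b \<Rightarrow> 'a) rel" where
  "ord_exp r s =
     {(f, g). f \<in> ord_exp_carrier r s \<and> g \<in> ord_exp_carrier r s \<and>
        (f = g \<or>
         (\<exists>x \<in> Field s. f x \<in> underS r (g x) \<and> (\<forall>y \<in> aboveS s x. f y = g y)))}"

text \<open>The whole space is put into the subbasis explicitly because of the one-point order, which
  has no nonempty open rays.\<close>

definition ord_topology :: "'a rel \<Rightarrow> 'a topology" where
  "ord_topology r =
     topology_generated_by (insert (Field r) (underS r ` Field r \<union> aboveS r ` Field r))"

definition closed_copy :: "'a rel \<Rightarrow> 'b rel \<Rightarrow> 'a set \<Rightarrow> bool" where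
  "closed_copy r s X \<longleftrightarrow> X \<subseteq> Field r \<and>
     (\<exists>h. iso (Restr r X) s h \<and>
          homeomorphic_map (subtopology (ord_topology r) X) (ord_topology s) h)"

datatype colour = Red | Blue

definition cl_arrow :: "'a rel \<Rightarrow> 'b rel \<Rightarrow> nat \<Rightarrow> bool" where
  "cl_arrow r s k \<longleftrightarrow>
     (\<forall>c :: 'a set \<Rightarrow> colour.
        (\<exists>X. closed_copy r s X \<and> (\<forall>e \<in> [X]\<^bsup>2\<^esup>. c e = Red)) \<or>
        (\<exists>Y \<in> [Field r]\<^bsup>k\<^esup>. \<forall>e \<in> [Y]\<^bsup>2\<^esup>. c e = Blue))"

end

theory Submission
  imports Defs
begin

text \<open>
  Let a colouring without a blue clique of size \<open>k\<close> be given. It is studied on the nodes of a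
  tree of finite height \<open>N\<close>, that is, on strictly increasing lists of at most \<open>N\<close> natural
  numbers, which are embedded into \<open>\<omega>\<^sup>\<omega>\<close> so that the children of a node converge to it (\<open>code\<close>).
  A pair of nodes involves at most \<open>2 * N\<close> numbers. Hence, by the infinite Ramsey theorem, the
  colour of a pair may be assumed to depend only on the order pattern of the entries of the two
  nodes (\<open>ex_order_invariant_subsequence\<close>, \<open>shape_determines_colour\<close>).

  A closed copy of \<open>\<omega>\<^sup>2\<close> consists of limit points \<open>y\<^sub>0 < y\<^sub>1 < \<dots>\<close> together with sequences \<open>x\<^sub>i\<^sub>j\<close>
  converging to \<open>y\<^sub>i\<close>. It is sought in the form \<open>y\<^sub>i = s @ [h\<^sub>i]\<close> and \<open>x\<^sub>i\<^sub>j = s @ [h\<^sub>i] @ t\<^sub>i\<^sub>j\<close>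
  with blocks \<open>t\<^sub>i\<^sub>j\<close> of a fixed length \<open>r\<close>. Convergence forces the blocks that belong to
  different \<open>i\<close> to alternate, but the blocks can be taken to be intervals in the set of all
  entries used. Then, up to the lengths of the nodes, only seven patterns occur.

  In three of them both nodes have the same length, and there are arbitrarily long sequences of
  nodes that pairwise have this pattern. If it were blue, such a sequence would be a blue clique.
  The other four are the patterns of a node \<open>y\<^sub>i\<close> and a node \<open>x\<^sub>k\<^sub>j\<close>. They depend on the lengths
  of the two nodes, and for any set of lengths there are nodes of these lengths which pairwise
  have the pattern in question (\<open>chain_shapes\<close>); this is why all \<open>y\<^sub>i\<close> share the prefix \<open>s\<close>. So
  if every pair of lengths made one of the four patterns blue, the finite Ramsey theorem, for \<open>N\<close>
  large in terms of \<open>k\<close>, would provide a blue clique (\<open>ex_unattained_levels\<close>). Otherwise there is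
  a pair of lengths for which all seven patterns are red, and the copy of \<open>\<omega>\<^sup>2\<close> built with these
  lengths is red (\<open>ex_unattained_tree\<close>, \<open>closed_copy_tree\<close>).
\<close>

section \<open>Order patterns of pairs of lists\<close>

text \<open>
  Ramsey's theorem is applied to one colouring after the other, each time shrinking the infinite
  set; the uniformity obtained before is inherited by subsets.
\<close>
lemma simultaneous_Ramsey:
  fixes P :: "(nat \<times> (nat set \<Rightarrow> bool)) set"
  assumes "finite P"
  shows "\<exists>H. infinite H \<and> (\<forall>d f. (d, f) \<in> P \<longrightarrow> (\<exists>v. \<forall>X \<subseteq> H. finite X \<longrightarrow> card X = d \<longrightarrow> f X = v))"
  using assms
proof (induction P rule: finite_induct)
  case empty
  then show ?case using infinite_UNIV_nat by blast
next
  case (insert q P)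
  obtain d f where q: "q = (d, f)" by fastforce
  from insert.IH obtain H where H: "infinite H"
    "\<And>d f. (d, f) \<in> P \<Longrightarrow> \<exists>v. \<forall>X \<subseteq> H. finite X \<longrightarrow> card X = d \<longrightarrow> f X = v" by blast
  have "\<forall>X. X \<subseteq> H \<and> finite X \<and> card X = d \<longrightarrow> of_bool (f X) < (2::nat)" by simp
  from Ramsey[OF H(1) this] obtain Y t where Y: "Y \<subseteq> H" "infinite Y"
    "\<forall>X. X \<subseteq> Y \<and> finite X \<and> card X = d \<longrightarrow> of_bool (f X) = (t::nat)" by blast
  have "\<exists>v. \<forall>X \<subseteq> Y. finite X \<longrightarrow> card X = d' \<longrightarrow> f' X = v" if "(d', f') \<in> insert q P" for d' f'
  proof (cases "(d', f') = q")
    case True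
    have "\<forall>X \<subseteq> Y. finite X \<longrightarrow> card X = d \<longrightarrow> f X = (t = 1)"
      using Y(3) by (metis of_bool_eq_1_iff)
    with True q show ?thesis by blast
  next
    case False
    with that H(2)[of d' f'] obtain v where "\<forall>X \<subseteq> H. finite X \<longrightarrow> card X = d' \<longrightarrow> f' X = v"
      by auto
    with Y(1) show ?thesis by (meson order.trans)
  qed
  with Y(2) show ?case by blast
qed

text \<open>
  A relation on lists that cannot see the values of the entries, only their relative order. The
  list \<open>xs\<close> is the merger of all entries involved, and \<open>M\<close> bounds the number of entries, because
  only finitely many order patterns can be handled at once.
\<close>
definition order_invariant :: "nat \<Rightarrow> (nat list \<Rightarrow> nat list \<Rightarrow> bool) \<Rightarrow> bool" where
  "order_invariant M F \<longleftrightarrow>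
     (\<forall>\<phi> xs A B. sorted_wrt (<) xs \<and> sorted_wrt (<) (map \<phi> xs) \<and> set A \<union> set B \<subseteq> set xs \<and>
        length xs \<le> M \<and> length A \<le> M \<and> length B \<le> M \<longrightarrow> F (map \<phi> A) (map \<phi> B) = F A B)"

text \<open>
  A pair of lists is described by the set \<open>X\<close> of their entries together with two lists of
  positions in \<open>X\<close>. For fixed positions this turns \<open>f\<close> into a colouring of finite sets of a fixed
  size, and there are only finitely many choices of positions. The sequence \<open>\<theta>\<close> enumerates a set
  that is homogeneous for all these colourings.
\<close>
lemma ex_order_invariant_subsequence:
  fixes f :: "nat list \<Rightarrow> nat list \<Rightarrow> bool"
  shows "\<exists>\<theta>. strict_mono \<theta> \<and> order_invariant M (\<lambda>A B. f (map \<theta> A) (map \<theta> B))"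
proof -
  define L where "L = {a. set a \<subseteq> {..<M} \<and> length a \<le> M}"
  define col where "col a b X = f (map ((!) (sorted_list_of_set X)) a) (map ((!) (sorted_list_of_set X)) b)"
    for a b and X :: "nat set"
  have "finite L" unfolding L_def by (rule finite_lists_length_le) simp
  then have "finite ((\<lambda>(d, a, b). (d, col a b)) ` ({..M} \<times> L \<times> L))" by blast
  from simultaneous_Ramsey[OF this] obtain H where "infinite H" and
    H': "\<forall>d g. (d, g) \<in> (\<lambda>(d, a, b). (d, col a b)) ` ({..M} \<times> L \<times> L) \<longrightarrow>
       (\<exists>v. \<forall>X \<subseteq> H. finite X \<longrightarrow> card X = d \<longrightarrow> g X = v)" by (elim exE conjE)
  have H: "\<exists>v. \<forall>X \<subseteq> H. finite X \<longrightarrow> card X = d \<longrightarrow> col a b X = v"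
    if "d \<le> M" "a \<in> L" "b \<in> L" for d a b
  proof -
    have "(d, col a b) \<in> (\<lambda>(d, a, b). (d, col a b)) ` ({..M} \<times> L \<times> L)"
      using that by (intro image_eqI[of _ _ "(d, a, b)"]) auto
    from H'[rule_format, OF this] show ?thesis by blast
  qed
  define \<theta> where "\<theta> = enumerate H"
  have mono: "strict_mono \<theta>" unfolding \<theta>_def using \<open>infinite H\<close> by (rule strict_mono_enumerate)
  have range: "\<theta> n \<in> H" for n unfolding \<theta>_def using \<open>infinite H\<close> by (rule enumerate_in_set)
  have sorted: "sorted_list_of_set (\<theta> ` set zs) = map \<theta> zs \<and> card (\<theta> ` set zs) = length zs"
    if "sorted_wrt (<) zs" for zs
  proof -
    have *: "sorted_wrt (<) (map \<theta> zs)"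
      using that mono by (simp add: sorted_wrt_map strict_mono_less)
    then have "sorted_list_of_set (set (map \<theta> zs)) = map \<theta> zs"
      by (metis strict_sorted_equal set_sorted_list_of_set strict_sorted_list_of_set List.finite_set)
    moreover have "card (set (map \<theta> zs)) = length zs"
      using * by (metis distinct_card length_map strict_sorted_iff)
    ultimately show ?thesis by simp
  qed
  have "f (map \<theta> (map \<phi> A)) (map \<theta> (map \<phi> B)) = f (map \<theta> A) (map \<theta> B)"
    if xs: "sorted_wrt (<) xs" "sorted_wrt (<) (map \<phi> xs)" "length xs \<le> M"
      and AB: "set A \<union> set B \<subseteq> set xs" "length A \<le> M" "length B \<le> M" for \<phi> xs A B
  proof -
    define pos where "pos v = (SOME i. i < length xs \<and> xs ! i = v)" for v
    have pos: "pos v < length xs \<and> xs ! pos v = v" if "v \<in> set xs" for v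
      unfolding pos_def by (rule someI_ex) (use that in \<open>simp add: in_set_conv_nth\<close>)
    have L: "map pos A \<in> L" "map pos B \<in> L"
      using AB xs(3) pos unfolding L_def by (fastforce simp: subset_iff)+
    have col: "col (map pos A) (map pos B) (\<theta> ` set zs) = f (map \<theta> (map \<psi> A)) (map \<theta> (map \<psi> B))"
      if "zs = map \<psi> xs" "sorted_wrt (<) zs" for \<psi> zs
    proof -
      have "map ((!) (map \<theta> zs)) (map pos C) = map \<theta> (map \<psi> C)" if "set C \<subseteq> set xs" for C
        using that pos \<open>zs = map \<psi> xs\<close> by (auto simp: subset_iff)
      then show ?thesis using AB(1) unfolding col_def conjunct1[OF sorted[OF that(2)]]
        by (metis Un_subset_iff)
    qed
    obtain v where v: "\<forall>X \<subseteq> H. finite X \<longrightarrow> card X = length xs \<longrightarrow> col (map pos A) (map pos B) X = v"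
      using H[OF xs(3) L] by blast
    have "col (map pos A) (map pos B) (\<theta> ` set zs) = v"
      if "length zs = length xs" "sorted_wrt (<) zs" for zs
      using v sorted[OF that(2)] that(1) range by (simp add: image_subset_iff)
    from this[of xs] this[of "map \<phi> xs"] col[of xs id] col[of "map \<phi> xs" \<phi>] xs show ?thesis
      by simp
  qed
  then show ?thesis using mono unfolding order_invariant_def by blast
qed

text \<open>
  The entries of two strictly increasing lists, merged in increasing order, fall into consecutive
  blocks that belong to both lists, only to the first one or only to the second one. The owners
  and the lengths of the blocks form the shape of the pair.
\<close>
datatype owner = Both | First | Second

definition has_shape :: "(owner \<times> nat) list \<Rightarrow> nat list \<Rightarrow> nat list \<Rightarrow> bool" where
  "has_shape \<sigma> A B \<longleftrightarrow>
     (\<exists>bs. map length bs = map snd \<sigma> \<and> sorted_wrt (<) (concat bs) \<and>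
        A = concat (map snd (filter (\<lambda>(w, b). w \<noteq> Second) (zip (map fst \<sigma>) bs))) \<and>
        B = concat (map snd (filter (\<lambda>(w, b). w \<noteq> First) (zip (map fst \<sigma>) bs))))"

text \<open>
  Two pairs of the same shape are matched by the increasing map between the mergers of their
  blocks.
\<close>
lemma shape_determines_colour:
  assumes F: "order_invariant M F" and M: "sum_list (map snd \<sigma>) \<le> M"
    and "has_shape \<sigma> A B" "has_shape \<sigma> A' B'"
  shows "F A B = F A' B'"
proof -
  define part where
    "part w bs = concat (map snd (filter (\<lambda>(w', b). w' \<noteq> w) (zip (map fst \<sigma>) bs)))"
    for w and bs :: "nat list list"
  obtain bs where bs: "map length bs = map snd \<sigma>" "sorted_wrt (<) (concat bs)"
    "A = part Second bs" "B = part First bs"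
    using assms(3) unfolding has_shape_def part_def by blast
  obtain cs where cs: "map length cs = map snd \<sigma>" "sorted_wrt (<) (concat cs)"
    "A' = part Second cs" "B' = part First cs"
    using assms(4) unfolding has_shape_def part_def by blast
  have len: "length (concat bs) = length (concat cs)"
    by (simp add: length_concat bs(1) cs(1))
  have "distinct (concat bs)" using bs(2) by (simp add: strict_sorted_iff)
  then obtain \<phi> where \<phi>: "map \<phi> (concat bs) = concat cs"
  proof -
    have "map (the \<circ> map_of (zip (concat bs) (concat cs))) (concat bs) = concat cs"
      using len \<open>distinct (concat bs)\<close> by (intro nth_equalityI) (simp_all add: map_of_zip_nth)
    then show thesis by (rule that)
  qed
  have bl: "length bs = length cs" using bs(1) cs(1) by (metis length_map)
  have "map (map \<phi>) bs = cs"
  proof (rule concat_injective)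
    show "concat (map (map \<phi>) bs) = concat cs" using \<phi> by (simp add: map_concat)
    show "\<forall>(x, y) \<in> set (zip (map (map \<phi>) bs) cs). length x = length y"
      using bs(1) cs(1) bl by (auto simp: set_zip) (metis length_map nth_map)
  qed (use bl in simp)
  then have image: "map \<phi> (part w bs) = part w cs" for w
    unfolding part_def by (auto simp: map_concat zip_map2 filter_map o_def case_prod_unfold)
  have "set (part w bs) \<subseteq> set (concat bs)" for w
    unfolding part_def by (auto dest: set_zip_rightD)
  moreover have part_le: "length (part w bs) \<le> M" for w
  proof -
    have *: "sum_list (map length (map snd (filter Q (zip ws ys)))) \<le> sum_list (map length ys)"
      for Q :: "owner \<times> nat list \<Rightarrow> bool" and ws ys
      by (induction ws ys rule: list_induct2') (auto intro: trans_le_add2)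
    show ?thesis using *[of _ "map fst \<sigma>" bs] M bs(1)
      unfolding part_def length_concat by (metis order.trans)
  qed
  moreover have "length (concat bs) \<le> M" using M by (simp add: length_concat bs(1))
  ultimately have "F (map \<phi> A) (map \<phi> B) = F A B"
    using F bs cs(2) \<phi> unfolding order_invariant_def by (metis Un_least)
  then show ?thesis using image bs cs by simp
qed

section \<open>Patterns that produce cliques\<close>

text \<open>
  A node stands for an ordinal below \<open>\<omega>\<^sup>\<omega>\<close>: the list \<open>[a\<^sub>1, \<dots>, a\<^sub>m]\<close> stands for
  \<open>\<omega>\<^sup>N\<^sup>-\<^sup>1 a\<^sub>1 + \<dots> + \<omega>\<^sup>N\<^sup>-\<^sup>m (a\<^sub>m + 1)\<close>, so that the nodes extending \<open>s\<close> by a large entry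
  converge to \<open>s\<close>. Up to the function \<open>code\<close> below, where this is made precise, nodes are merely
  lists, and \<open>F\<close> is to be thought of as the relation of being joined by a blue edge.
\<close>
definition nodes :: "nat \<Rightarrow> nat list set" where
  "nodes N = {xs. sorted_wrt (<) xs \<and> xs \<noteq> [] \<and> length xs \<le> N}"

definition has_clique :: "nat \<Rightarrow> nat \<Rightarrow> (nat list \<Rightarrow> nat list \<Rightarrow> bool) \<Rightarrow> bool" where
  "has_clique N k F \<longleftrightarrow>
     (\<exists>Z \<subseteq> nodes N. finite Z \<and> card Z = k \<and> (\<forall>A \<in> Z. \<forall>B \<in> Z. A \<noteq> B \<longrightarrow> F A B))"

definition attained :: "(nat list \<Rightarrow> nat list \<Rightarrow> bool) \<Rightarrow> (owner \<times> nat) list \<Rightarrow> bool" where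
  "attained F \<sigma> \<longleftrightarrow> (\<exists>A B. has_shape \<sigma> A B \<and> F A B)"

text \<open>
  Under order invariance a family of lists is a clique as soon as the shape of each of its pairs
  occurs at least once as the shape of a related pair.
\<close>
lemma has_clique_family:
  fixes z :: "nat \<Rightarrow> nat list"
  assumes "order_invariant M F" and sym: "symp F"
    and I: "finite I" "card I = k" "inj_on z I" "\<And>i. i \<in> I \<Longrightarrow> z i \<in> nodes N"
    and \<sigma>: "\<And>i j. i \<in> I \<Longrightarrow> j \<in> I \<Longrightarrow> i < j \<Longrightarrow>
      has_shape (\<sigma> i j) (z i) (z j) \<and> attained F (\<sigma> i j) \<and> sum_list (map snd (\<sigma> i j)) \<le> M"
  shows "has_clique N k F"
proof -
  have F: "F (z i) (z j)" if "i \<in> I" "j \<in> I" "i < j" for i j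
    using \<sigma>[OF that] shape_determines_colour[OF assms(1)] unfolding attained_def by blast
  have "F (z i) (z j)" if "i \<in> I" "j \<in> I" "z i \<noteq> z j" for i j
    using F[of i j] F[of j i] sympD[OF sym] that by (metis linorder_neqE_nat)
  then show ?thesis unfolding has_clique_def
    using I by (intro exI[of _ "z ` I"]) (auto simp: card_image)
qed

text \<open>
  Each of these three shapes is shared by all pairs from arbitrarily long sequences of nodes. The
  following lemmas exhibit such sequences.
\<close>
abbreviation "parallel p q \<equiv> [(Both, p), (First, q), (Second, q)]"
abbreviation "interleaved p r \<equiv> [(Both, p), (First, 1), (Second, 1), (First, r), (Second, r)]"
abbreviation "nested p r \<equiv> [(Both, p), (First, 1), (Second, 1), (Second, r), (First, r)]"

lemma clique_parallel:
  assumes "order_invariant M F" "symp F" and blue: "attained F (parallel p q)"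
    and "0 < q" "p + q \<le> N" "p + 2 * q \<le> M"
  shows "has_clique N k F"
proof -
  define a where "a i = p + i * q" for i
  have a: "p \<le> a i" "i < j \<Longrightarrow> a i + q \<le> a j" for i j
  proof -
    show "a i + q \<le> a j" if "i < j"
      using mult_le_mono1[of "Suc i" j q] that by (simp add: a_def)
  qed (simp add: a_def)
  define z where "z i = [0..<p] @ [a i..<a i + q]" for i
  have "z i ! p = a i" for i using \<open>0 < q\<close> by (simp add: z_def nth_append)
  then have inj: "inj z" using \<open>0 < q\<close> by (intro injI) (metis a_def add_left_cancel mult_cancel2 less_irrefl)
  show ?thesis
  proof (rule has_clique_family[OF assms(1,2), of "{..<k}" k z N "\<lambda>_ _. parallel p q"])
    show "z i \<in> nodes N" for i
      using assms a(1)[of i] by (auto simp: nodes_def z_def sorted_wrt_append)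
    show "has_shape (parallel p q) (z i) (z j) \<and> attained F (parallel p q) \<and>
        sum_list (map snd (parallel p q)) \<le> M" if "i < j" for i j
      unfolding has_shape_def
      using a(1)[of i] a(1)[of j] a(2)[OF that] blue \<open>p + 2 * q \<le> M\<close>
      by (intro conjI exI[of _ "[[0..<p], [a i..<a i + q], [a j..<a j + q]]"])
        (auto simp: z_def sorted_wrt_append)
  qed (auto intro: inj_on_subset[OF inj])
qed

lemma clique_interleaved:
  assumes "order_invariant M F" "symp F" and blue: "attained F (interleaved p r)"
    and "p + r < N" "p + 2 * r + 2 \<le> M"
  shows "has_clique N k F"
proof -
  define a where "a i = p + k + i * r" for i
  have a: "p + k \<le> a i" "i < j \<Longrightarrow> a i + r \<le> a j" for i j
  proof -
    show "a i + r \<le> a j" if "i < j"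
      using mult_le_mono1[of "Suc i" j r] that by (simp add: a_def)
  qed (simp add: a_def)
  define z where "z i = [0..<p] @ [p + i] @ [a i..<a i + r]" for i
  have "z i ! p = p + i" for i by (simp add: z_def nth_append)
  then have inj: "inj z" by (intro injI) (metis add_left_cancel)
  show ?thesis
  proof (rule has_clique_family[OF assms(1,2), of "{..<k}" k z N "\<lambda>_ _. interleaved p r"])
    show "z i \<in> nodes N" if "i \<in> {..<k}" for i
      using that assms a(1)[of i] by (auto simp: nodes_def z_def sorted_wrt_append)
    show "has_shape (interleaved p r) (z i) (z j) \<and> attained F (interleaved p r) \<and>
        sum_list (map snd (interleaved p r)) \<le> M" if "i \<in> {..<k}" "j \<in> {..<k}" "i < j" for i j
      unfolding has_shape_def
      using that a(1)[of i] a(1)[of j] a(2)[OF \<open>i < j\<close>] blue \<open>p + 2 * r + 2 \<le> M\<close>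
      by (intro conjI exI[of _ "[[0..<p], [p + i], [p + j], [a i..<a i + r], [a j..<a j + r]]"])
        (auto simp: z_def sorted_wrt_append)
  qed (auto intro: inj_on_subset[OF inj])
qed

text \<open>
  The final blocks come in the reverse order of the single entries, which is why the block of the
  \<open>i\<close>-th node starts at a number that decreases with \<open>i\<close>.
\<close>
lemma clique_nested:
  assumes "order_invariant M F" "symp F" and blue: "attained F (nested p r)"
    and "p + r < N" "p + 2 * r + 2 \<le> M"
  shows "has_clique N k F"
proof -
  define a where "a i = p + k + (k - i) * r" for i
  have a: "p + k \<le> a i" "i < j \<Longrightarrow> j < k \<Longrightarrow> a j + r \<le> a i" for i j
  proof -
    show "a j + r \<le> a i" if "i < j" "j < k"
    proof -
      have "Suc (k - j) \<le> k - i" using that by linarith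
      from mult_le_mono1[OF this, of r] show ?thesis by (simp add: a_def)
    qed
  qed (simp add: a_def)
  define z where "z i = [0..<p] @ [p + i] @ [a i..<a i + r]" for i
  have "z i ! p = p + i" for i by (simp add: z_def nth_append)
  then have inj: "inj z" by (intro injI) (metis add_left_cancel)
  show ?thesis
  proof (rule has_clique_family[OF assms(1,2), of "{..<k}" k z N "\<lambda>_ _. nested p r"])
    show "z i \<in> nodes N" if "i \<in> {..<k}" for i
      using that assms a(1)[of i] by (auto simp: nodes_def z_def sorted_wrt_append)
    show "has_shape (nested p r) (z i) (z j) \<and> attained F (nested p r) \<and>
        sum_list (map snd (nested p r)) \<le> M" if "i \<in> {..<k}" "j \<in> {..<k}" "i < j" for i j
      unfolding has_shape_def
      using that a(1)[of i] a(1)[of j] a(2)[OF \<open>i < j\<close>] blue \<open>p + 2 * r + 2 \<le> M\<close>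
      by (intro conjI exI[of _ "[[0..<p], [p + i], [p + j], [a j..<a j + r], [a i..<a i + r]]"])
        (auto simp: z_def sorted_wrt_append)
  qed (auto intro: inj_on_subset[OF inj])
qed

section \<open>Patterns that depend on the lengths of the nodes\<close>

text \<open>
  In these shapes the first node is \<open>s @ [b]\<close> and the second one is \<open>s @ [h] @ t\<close>, where \<open>p\<close> is
  the length of \<open>s\<close> and \<open>r\<close> that of \<open>t\<close>. The entry \<open>b\<close> is equal to \<open>h\<close>, smaller than \<open>h\<close>, between
  \<open>h\<close> and the entries of \<open>t\<close>, or larger than all of them.
\<close>
definition extending :: "nat \<Rightarrow> nat \<Rightarrow> (owner \<times> nat) list" where
  "extending p r = [(Both, p + 1), (Second, r)]"
definition before :: "nat \<Rightarrow> nat \<Rightarrow> (owner \<times> nat) list" where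
  "before p r = [(Both, p), (First, 1), (Second, 1 + r)]"
definition inserted :: "nat \<Rightarrow> nat \<Rightarrow> (owner \<times> nat) list" where
  "inserted p r = [(Both, p), (Second, 1), (First, 1), (Second, r)]"
definition beyond :: "nat \<Rightarrow> nat \<Rightarrow> (owner \<times> nat) list" where
  "beyond p r = [(Both, p), (Second, 1 + r), (First, 1)]"

lemmas chain_shape_defs = extending_def before_def inserted_def beyond_def

text \<open>
  For \<open>r > 0\<close> not even three nodes can have all their pairs of one and the same shape of this
  kind, since the shape prescribes the lengths. But there are families with one node of each
  length in which every pair has the shape that belongs to its lengths. The nodes run along a
  common sequence, here the even numbers \<open>2, 4, 6, \<dots>\<close>, and only their last entries \<open>b q\<close> are
  free; the lower bound makes the nodes increasing. The common prefixes matter. For two disjoint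
  nodes, the analogue of the third shape would put the whole shorter node, of length \<open>m\<close>, between
  the \<open>m\<close>-th and the next entry of the longer one, and no three nodes of different lengths can
  have this position pairwise.
\<close>
definition chain_shape :: "nat \<Rightarrow> (nat \<Rightarrow> nat \<Rightarrow> (owner \<times> nat) list) \<Rightarrow> bool" where
  "chain_shape N \<tau> \<longleftrightarrow>
     (\<exists>b. \<forall>q < N. 2 * q < b q \<and>
        (\<forall>p < q. has_shape (\<tau> p (q - p))
           (map (\<lambda>i. 2 * i + 2) [0..<p] @ [b p]) (map (\<lambda>i. 2 * i + 2) [0..<q] @ [b q])))"

lemma split_evens:
  "p \<le> q \<Longrightarrow> map (\<lambda>i. 2 * i + 2) [0..<q] = map (\<lambda>i. 2 * i + 2) [0..<p] @ map (\<lambda>i. 2 * i + 2) [p..<q]"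
  using upt_add_eq_append[of 0 p "q - p"] by simp

text \<open>
  The last entry of a node is the next even number of the common sequence, one less, one more, or
  a number beyond this sequence that decreases with the length of the node.
\<close>
lemma chain_shapes:
  assumes "\<tau> \<in> {extending, before, inserted, beyond}"
  shows "chain_shape N \<tau>"
proof -
  let ?e = "map (\<lambda>i::nat. 2 * i + 2)"
  have "chain_shape N extending"
    unfolding chain_shape_def
  proof (intro exI[of _ "\<lambda>p. 2 * p + 2"] allI impI conjI)
    fix p q :: nat assume "p < q"
    have snoc: "?e [0..<n] @ [2 * n + 2] = ?e [0..<Suc n]" for n by simp
    show "has_shape (extending p (q - p)) (?e [0..<p] @ [2 * p + 2]) (?e [0..<q] @ [2 * q + 2])"
      unfolding has_shape_def snoc split_evens[of "Suc p" "Suc q", OF Suc_leI[OF less_SucI[OF \<open>p < q\<close>]]]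
      by (intro exI[of _ "[?e [0..<Suc p], ?e [Suc p..<Suc q]]"])
        (auto simp: extending_def sorted_wrt_append sorted_wrt_map less_imp_le[OF \<open>p < q\<close>] simp del: upt_Suc)
  qed simp
  moreover have "chain_shape N before"
    unfolding chain_shape_def
  proof (intro exI[of _ "\<lambda>p. 2 * p + 1"] allI impI conjI)
    fix p q :: nat assume "p < q"
    then show "has_shape (before p (q - p)) (?e [0..<p] @ [2 * p + 1]) (?e [0..<q] @ [2 * q + 1])"
      unfolding has_shape_def split_evens[OF less_imp_le[OF \<open>p < q\<close>]]
      by (intro exI[of _ "[?e [0..<p], [2 * p + 1], ?e [p..<q] @ [2 * q + 1]]"])
        (auto simp: before_def sorted_wrt_append sorted_wrt_map)
  qed simp
  moreover have "chain_shape N inserted"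
    unfolding chain_shape_def
  proof (intro exI[of _ "\<lambda>p. 2 * p + 3"] allI impI conjI)
    fix p q :: nat assume "p < q"
    then show "has_shape (inserted p (q - p)) (?e [0..<p] @ [2 * p + 3]) (?e [0..<q] @ [2 * q + 3])"
      unfolding has_shape_def split_evens[OF less_imp_le[OF \<open>p < q\<close>]]
      by (intro exI[of _ "[?e [0..<p], [2 * p + 2], [2 * p + 3], ?e [Suc p..<q] @ [2 * q + 3]]"])
        (auto simp: inserted_def sorted_wrt_append sorted_wrt_map upt_conv_Cons)
  qed simp
  moreover have "chain_shape N beyond"
    unfolding chain_shape_def
  proof (intro exI[of _ "\<lambda>p. 3 * N - p"] allI impI conjI)
    fix p q :: nat assume "q < N" "p < q"
    then show "has_shape (beyond p (q - p)) (?e [0..<p] @ [3 * N - p]) (?e [0..<q] @ [3 * N - q])"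
      unfolding has_shape_def split_evens[OF less_imp_le[OF \<open>p < q\<close>]]
      by (intro exI[of _ "[?e [0..<p], ?e [p..<q] @ [3 * N - q], [3 * N - p]]"])
        (auto simp: beyond_def sorted_wrt_append sorted_wrt_map)
  qed simp
  ultimately show ?thesis using assms by blast
qed

lemma clique_chain:
  assumes F: "order_invariant M F" "symp F" and \<tau>: "\<tau> \<in> {extending, before, inserted, beyond}"
    and I: "finite I" "I \<subseteq> {..<N}" and NM: "2 * N \<le> M"
    and blue: "\<And>p q. p \<in> I \<Longrightarrow> q \<in> I \<Longrightarrow> p < q \<Longrightarrow> attained F (\<tau> p (q - p))"
  shows "has_clique N (card I) F"
proof -
  obtain b where b: "\<And>q. q < N \<Longrightarrow> 2 * q < b q"
    "\<And>p q. p < q \<Longrightarrow> q < N \<Longrightarrow> has_shape (\<tau> p (q - p))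
       (map (\<lambda>i. 2 * i + 2) [0..<p] @ [b p]) (map (\<lambda>i. 2 * i + 2) [0..<q] @ [b q])"
    using chain_shapes[OF \<tau>, of N] unfolding chain_shape_def by blast
  define z where "z p = map (\<lambda>i. 2 * i + 2) [0..<p] @ [b p]" for p
  have "length (z p) = Suc p" for p by (simp add: z_def)
  then have "inj z" by (metis injI nat.inject)
  show ?thesis
  proof (rule has_clique_family[OF F I(1) refl, of z N "\<lambda>p q. \<tau> p (q - p)"])
    show "z p \<in> nodes N" if "p \<in> I" for p
      using that I(2) b(1)[of p] by (fastforce simp: nodes_def z_def sorted_wrt_append sorted_wrt_map)
    show "has_shape (\<tau> p (q - p)) (z p) (z q) \<and> attained F (\<tau> p (q - p)) \<and>
        sum_list (map snd (\<tau> p (q - p))) \<le> M" if "p \<in> I" "q \<in> I" "p < q" for p q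
      using b(2)[of p q] blue[OF that] that I(2) \<tau> NM
      by (auto simp: z_def chain_shape_defs subset_iff)
  qed (use \<open>inj z\<close> in \<open>auto intro: inj_on_subset\<close>)
qed

text \<open>
  Pairs of lengths are coloured with the first chain shape that is attained there, or with a
  fifth colour if there is none. A homogeneous set in one of the first four colours would give a
  clique, so the finite Ramsey theorem provides a pair in the fifth colour.
\<close>
lemma ex_unattained_levels:
  assumes F: "order_invariant M F" "symp F" and NM: "2 * N \<le> M"
    and noclique: "\<not> has_clique N k F" and N: "partn_lst {..<N} [k, k, k, k, 2] 2"
  shows "\<exists>p r. 0 < r \<and> p + r < N \<and>
    (\<forall>\<tau> \<in> {extending, before, inserted, beyond}. \<not> attained F (\<tau> p r))"
proof -
  define chains where "chains = [extending, before, inserted, beyond]"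
  have len: "length chains = 4" by (simp add: chains_def)
  define pair_colour where
    "pair_colour e = length (takeWhile (\<lambda>\<tau>. \<not> attained F (\<tau> (Min e) (Max e - Min e))) chains)"
    for e :: "nat set"
  have "pair_colour e \<le> 4" for e
    unfolding pair_colour_def by (rule order.trans[OF length_takeWhile_le]) (simp add: chains_def)
  then have "pair_colour e < 5" for e using le_less_trans[of "pair_colour e" 4 5] by simp
  then have "pair_colour \<in> nsets {..<N} 2 \<rightarrow> {..<5}" by blast
  moreover have "length [k, k, k, k, 2] = 5" by simp
  ultimately obtain i where i: "i < 5" "monochromatic {..<N} ([k, k, k, k, 2] ! i) 2 pair_colour i"
    using N unfolding partn_lst_def by metis
  then obtain I where I: "I \<in> nsets {..<N} ([k, k, k, k, 2] ! i)" "pair_colour ` nsets I 2 \<subseteq> {i}"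
    unfolding monochromatic_def by blast
  have pair_colour: "length (takeWhile (\<lambda>\<tau>. \<not> attained F (\<tau> p (q - p))) chains) = i"
    if "p \<in> I" "q \<in> I" "p < q" for p q
  proof -
    have "{p, q} \<in> nsets I 2" using that by simp
    with I(2) have "pair_colour {p, q} = i" by blast
    with \<open>p < q\<close> show ?thesis by (simp add: pair_colour_def)
  qed
  show ?thesis
  proof (cases "i = 4")
    case True
    with I(1) have "I \<subseteq> {..<N}" "card I = 2" by (auto simp: nsets_def)
    then obtain p q where pq: "p \<in> I" "q \<in> I" "p < q" "q < N"
      by (auto simp: card_2_iff) (metis linorder_neqE_nat)
    have "takeWhile (\<lambda>\<tau>. \<not> attained F (\<tau> p (q - p))) chains = chains"
      using pair_colour[OF pq(1-3)] True len by (metis takeWhile_eq_take take_all order_refl)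
    then have "\<forall>\<tau> \<in> set chains. \<not> attained F (\<tau> p (q - p))" by (simp add: takeWhile_eq_all_conv)
    then show ?thesis using pq by (intro exI[of _ p] exI[of _ "q - p"]) (auto simp: chains_def)
  next
    case False
    with i have "i < 4" by simp
    then have "[k, k, k, k, 2] ! i = k" by (auto simp: numeral_eq_Suc less_Suc_eq)
    with I(1) have I': "finite I" "card I = k" "I \<subseteq> {..<N}" by (auto simp: nsets_def)
    have "attained F ((chains ! i) p (q - p))" if "p \<in> I" "q \<in> I" "p < q" for p q
      using pair_colour[OF that] \<open>i < 4\<close> len nth_length_takeWhile[of "\<lambda>\<tau>. \<not> attained F (\<tau> p (q - p))" chains]
      by auto
    moreover have "chains ! i \<in> {extending, before, inserted, beyond}"
      using \<open>i < 4\<close> len nth_mem[of i chains] by (auto simp: chains_def)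
    ultimately have "has_clique N k F"
      using clique_chain[OF F _ I'(1,3) NM, of "chains ! i"] I'(2) by blast
    with noclique show ?thesis ..
  qed
qed

section \<open>A tree of type \<open>\<omega>\<^sup>2\<close> without related pairs\<close>

text \<open>
  Nodes \<open>y\<^sub>i = s @ [h i]\<close>, together with nodes \<open>x\<^sub>i\<^sub>j\<close> that extend \<open>y\<^sub>i\<close> and whose first
  additional entry \<open>c i j\<close> tends to infinity with \<open>j\<close>, so that the \<open>x\<^sub>i\<^sub>j\<close> converge to \<open>y\<^sub>i\<close>. The
  condition on \<open>w\<close> makes the contributions of the digits \<open>c i j\<close> comparable for fixed \<open>i\<close>, as the
  last entry of a node contributes one more than its value. For the same reason \<open>c k j\<close> has to be
  positive: if \<open>h k = h i + 1\<close>, then \<open>y\<^sub>i\<close> is smaller than \<open>x\<^sub>k\<^sub>j\<close> only by this digit.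
\<close>
definition tree_nodes ::
  "nat list \<Rightarrow> (nat \<Rightarrow> nat) \<Rightarrow> (nat \<Rightarrow> nat \<Rightarrow> nat) \<Rightarrow> (nat \<Rightarrow> nat \<Rightarrow> nat list) \<Rightarrow> nat list set" where
  "tree_nodes s h c w = range (\<lambda>i. s @ [h i]) \<union> range (\<lambda>(i, j). s @ h i # c i j # w i j)"

definition convergent_tree ::
  "nat \<Rightarrow> nat list \<Rightarrow> (nat \<Rightarrow> nat) \<Rightarrow> (nat \<Rightarrow> nat \<Rightarrow> nat) \<Rightarrow> (nat \<Rightarrow> nat \<Rightarrow> nat list) \<Rightarrow> bool" where
  "convergent_tree N s h c w \<longleftrightarrow>
     (\<forall>i j. length (s @ h i # c i j # w i j) \<le> N) \<and> strict_mono h \<and>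
     (\<forall>i. strict_mono (c i)) \<and> (\<forall>i j. 0 < c i j) \<and> (\<forall>i j j'. w i j = [] \<longleftrightarrow> w i j' = [])"

lemma convergent_tree_map:
  assumes "strict_mono \<theta>" "convergent_tree N s h c w"
  shows "convergent_tree N (map \<theta> s) (\<lambda>i. \<theta> (h i)) (\<lambda>i j. \<theta> (c i j)) (\<lambda>i j. map \<theta> (w i j))"
proof -
  have "0 < \<theta> n" if "0 < n" for n
    using that strict_mono_imp_increasing[OF assms(1), of n] by simp
  then show ?thesis using assms by (simp add: convergent_tree_def strict_mono_def)
qed

lemma tree_nodes_map:
  "tree_nodes (map \<theta> s) (\<lambda>i. \<theta> (h i)) (\<lambda>i j. \<theta> (c i j)) (\<lambda>i j. map \<theta> (w i j)) =
   map \<theta> ` tree_nodes s h c w"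
  by (auto simp: tree_nodes_def image_Un image_image case_prod_unfold)

text \<open>
  The prefix \<open>s\<close> is common to all nodes, and the numbers above it are divided into consecutive
  slots of length \<open>r\<close>. The pairing function assigns slots to the entries \<open>h i\<close>, which are the
  first numbers of their slots, and to the blocks \<open>T i j\<close> of the final entries of \<open>x i j\<close>, in
  such a way that \<open>h i\<close> comes before all \<open>T i j\<close> and these come in the order of \<open>j\<close>. Since
  infinitely many blocks belong to each \<open>h i\<close>, those of different \<open>h i\<close> alternate; but as each
  slot is an interval, every pair of nodes has one of the seven shapes considered above, and \<open>p\<close>
  and \<open>r\<close> are chosen such that none of these is attained.
\<close>
lemma ex_unattained_tree:
  assumes F: "order_invariant M F" "symp F" and noclique: "\<not> has_clique N k F"
    and N: "partn_lst {..<N} [k, k, k, k, 2] 2" and M: "2 * N \<le> M"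
  shows "\<exists>s h c w. convergent_tree N s h c w \<and>
    (\<forall>A \<in> tree_nodes s h c w. \<forall>B \<in> tree_nodes s h c w. A \<noteq> B \<longrightarrow> \<not> F A B)"
proof -
  obtain p r where pr: "0 < r" "p + r < N"
    and chain: "\<forall>\<tau> \<in> {extending, before, inserted, beyond}. \<not> attained F (\<tau> p r)"
    using ex_unattained_levels[OF F M noclique N] by (elim exE conjE)
  have no_parallel: "\<not> attained F (parallel p q)" if "0 < q" "p + q \<le> N" "p + 2 * q \<le> M" for p q
    using noclique clique_parallel[OF F _ that] by blast
  have homogeneous:
    "\<not> attained F (parallel p 1)" "\<not> attained F (parallel (p + 1) r)" "\<not> attained F (parallel p (1 + r))"
    by (rule no_parallel; use pr M in simp)+
  have "\<not> attained F (interleaved p r)" "\<not> attained F (nested p r)"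
    using noclique pr M clique_interleaved[OF F, of p r N k] clique_nested[OF F, of p r N k] by auto
  note homogeneous = homogeneous this
  \<comment> \<open>the first number of the \<open>n\<close>-th slot\<close>
  define start where "start n = p + r * n" for n
  have start: "start m + r \<le> start n" if "m < n" for m n
    using mult_le_mono2[of "Suc m" n r] that by (simp add: start_def)
  then have start_less: "start m < start n" if "m < n" for m n
    using that pr(1) by (metis add.commute less_add_same_cancel2 order_less_le_trans)
  define h where "h i = start (prod_encode (i, 0))" for i
  define c where "c i j = start (prod_encode (i, Suc j))" for i j
  define T where "T i j = [c i j..<c i j + r]" for i j
  define y where "y i = [0..<p] @ [h i]" for i
  define x where "x i j = [0..<p] @ h i # T i j" for i j
  have p_h: "p \<le> h i" and p_c: "p \<le> c i j" for i j by (simp_all add: h_def c_def start_def)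
  have triangle_less: "triangle a < triangle b" if "a < b" for a b
    using that by (induction b) (auto simp: less_Suc_eq)
  have encode_less_fst: "prod_encode (i, j) < prod_encode (i', j)" if "i < i'" for i i' j
    using triangle_less[of "i + j" "i' + j"] that by (simp add: prod_encode_def)
  have encode_less_snd: "prod_encode (i, j) < prod_encode (i, j')" if "j < j'" for i j j'
    using triangle_less[of "i + j" "i + j'"] that by (simp add: prod_encode_def)
  have h_less: "h i < h i'" if "i < i'" for i i'
    unfolding h_def by (intro start_less encode_less_fst that)
  have hc: "h i < c i j" for i j
    unfolding h_def c_def by (intro start_less encode_less_snd) simp
  have cc: "c i j + r \<le> c i j'" if "j < j'" for i j j'
    unfolding c_def by (intro start encode_less_snd) (use that in simp)
  have hc_cases: "c i j + r \<le> h i' \<or> h i' < c i j" for i i' j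
    using start[of "prod_encode (i, Suc j)" "prod_encode (i', 0)"]
      start_less[of "prod_encode (i', 0)" "prod_encode (i, Suc j)"]
    unfolding h_def c_def by (metis linorder_neqE_nat nat.distinct(1) prod.inject prod_encode_eq)
  have cc_cases: "c i j + r \<le> c i' j' \<or> c i' j' + r \<le> c i j" if "i \<noteq> i'" for i i' j j'
    using start[of "prod_encode (i, Suc j)" "prod_encode (i', Suc j')"]
      start[of "prod_encode (i', Suc j')" "prod_encode (i, Suc j)"] that
    unfolding c_def by (metis linorder_neqE_nat prod.inject prod_encode_eq)
  have not_related: "\<not> F A B" if "has_shape \<sigma> A B" "\<not> attained F \<sigma>" for \<sigma> A B
    using that unfolding attained_def by blast
  have yy: "\<not> F (y i) (y i')" if "i < i'" for i i'
  proof (rule not_related[OF _ homogeneous(1)])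
    show "has_shape (parallel p 1) (y i) (y i')"
      unfolding has_shape_def
        using p_h[of i] p_h[of i'] h_less[OF that]
      by (intro exI[of _ "[[0..<p], [h i], [h i']]"]) (auto simp: y_def sorted_wrt_append)
  qed
  have yx: "\<not> F (y i) (x i' j)" for i i' j
  proof -
    consider "i = i'" | "i < i'" | "i' < i" "h i < c i' j" | "i' < i" "c i' j + r \<le> h i"
      using hc_cases[of i' j i] by linarith
    then show ?thesis
    proof cases
      case 1
      have "has_shape (extending p r) (y i) (x i' j)"
        unfolding has_shape_def 1 using p_h[of i'] p_c[of i' j] hc[of i' j]
        by (intro exI[of _ "[[0..<p] @ [h i'], T i' j]"])
          (auto simp: y_def x_def T_def extending_def sorted_wrt_append)
      then show ?thesis by (rule not_related) (simp add: chain)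
    next
      case 2
      have "has_shape (before p r) (y i) (x i' j)"
        unfolding has_shape_def
        using p_h[of i] p_c[of i j] p_h[of i'] p_c[of i' j] hc[of i' j] h_less[OF 2]
        by (intro exI[of _ "[[0..<p], [h i], h i' # T i' j]"])
          (auto simp: y_def x_def T_def before_def sorted_wrt_append)
      then show ?thesis by (rule not_related) (simp add: chain)
    next
      case 3
      have "has_shape (inserted p r) (y i) (x i' j)"
        unfolding has_shape_def
        using p_h[of i] p_c[of i j] p_h[of i'] p_c[of i' j] hc[of i' j] h_less[OF 3(1)] 3(2)
        by (intro exI[of _ "[[0..<p], [h i'], [h i], T i' j]"])
          (auto simp: y_def x_def T_def inserted_def sorted_wrt_append)
      then show ?thesis by (rule not_related) (simp add: chain)
    next
      case 4
      have "has_shape (beyond p r) (y i) (x i' j)"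
        unfolding has_shape_def
        using p_h[of i] p_c[of i j] p_h[of i'] p_c[of i' j] hc[of i' j] h_less[OF 4(1)] 4(2)
        by (intro exI[of _ "[[0..<p], h i' # T i' j, [h i]]"])
          (auto simp: y_def x_def T_def beyond_def sorted_wrt_append)
      then show ?thesis by (rule not_related) (simp add: chain)
    qed
  qed
  have xx_same: "\<not> F (x i j) (x i j')" if "j < j'" for i j j'
  proof (rule not_related[OF _ homogeneous(2)])
    show "has_shape (parallel (p + 1) r) (x i j) (x i j')"
      unfolding has_shape_def
        using p_h[of i] p_c[of i j] hc[of i j] cc[OF that, of i]
      by (intro exI[of _ "[[0..<p] @ [h i], T i j, T i j']"])
        (auto simp: x_def T_def sorted_wrt_append)
  qed
  have xx: "\<not> F (x i j) (x i' j')" if "i < i'" for i i' j j'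
  proof -
    note facts = p_h[of i] p_c[of i j] p_h[of i'] p_c[of i' j'] hc[of i j] hc[of i' j'] h_less[OF that]
    consider "c i j + r \<le> h i'" | "h i' < c i j" "c i j + r \<le> c i' j'"
      | "h i' < c i j" "c i' j' + r \<le> c i j"
      using hc_cases[of i j i'] cc_cases[OF less_imp_neq[OF \<open>i < i'\<close>], of j j'] by blast
    then show ?thesis
    proof cases
      case 1
      have "has_shape (parallel p (1 + r)) (x i j) (x i' j')"
        unfolding has_shape_def using facts 1
        by (intro exI[of _ "[[0..<p], h i # T i j, h i' # T i' j']"])
          (auto simp: x_def T_def sorted_wrt_append)
      then show ?thesis using homogeneous(3) by (rule not_related)
    next
      case 2
      have "has_shape (interleaved p r) (x i j) (x i' j')"
        unfolding has_shape_def using facts 2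
        by (intro exI[of _ "[[0..<p], [h i], [h i'], T i j, T i' j']"])
          (auto simp: x_def T_def sorted_wrt_append)
      then show ?thesis using homogeneous(4) by (rule not_related)
    next
      case 3
      have "has_shape (nested p r) (x i j) (x i' j')"
        unfolding has_shape_def using facts 3
        by (intro exI[of _ "[[0..<p], [h i], [h i'], T i' j', T i j]"])
          (auto simp: x_def T_def sorted_wrt_append)
      then show ?thesis using homogeneous(5) by (rule not_related)
    qed
  qed
  have sym: "F A B \<longleftrightarrow> F B A" for A B using F(2) by (auto dest: sympD)
  have T: "T i j = c i j # [Suc (c i j)..<c i j + r]" for i j
    using pr(1) by (simp add: T_def upt_conv_Cons)
  have nodes: "tree_nodes [0..<p] h c (\<lambda>i j. [Suc (c i j)..<c i j + r]) = range y \<union> range (\<lambda>(i, j). x i j)"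
    unfolding tree_nodes_def x_def y_def T ..
  have "convergent_tree N [0..<p] h c (\<lambda>i j. [Suc (c i j)..<c i j + r])"
    unfolding convergent_tree_def
  proof (intro conjI allI)
    show "strict_mono h" using h_less by (rule strict_monoI)
    show "strict_mono (c i)" for i
    proof (rule strict_monoI)
      show "c i j < c i j'" if "j < j'" for j j' using cc[OF that, of i] pr(1) by simp
    qed
    show "0 < c i j" for i j using hc[of i j] by simp
    show "length ([0..<p] @ h i # c i j # [Suc (c i j)..<c i j + r]) \<le> N" for i j
      using pr by simp
  qed (use pr(1) in auto)
  moreover have "\<not> F A B" if AB: "A \<in> range y \<union> range (\<lambda>(i, j). x i j)"
    "B \<in> range y \<union> range (\<lambda>(i, j). x i j)" "A \<noteq> B" for A B
  proof -
    have yy': "\<not> F (y i) (y i')" if "y i \<noteq> y i'" for i i'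
      using yy[of i i'] yy[of i' i] sym that by (metis linorder_neqE_nat)
    have xx': "\<not> F (x i j) (x i' j')" if "x i j \<noteq> x i' j'" for i i' j j'
      using xx[of i i' j j'] xx[of i' i j' j] xx_same[of j j' i] xx_same[of j' j i] sym that
      by (metis linorder_neqE_nat)
    have xy: "\<not> F (x i j) (y i')" for i i' j using yx[of i' i j] sym by blast
    show ?thesis using AB yx xy yy' xx' by auto
  qed
  ultimately show ?thesis unfolding nodes[symmetric] by blast
qed

section \<open>Closed copies of \<open>\<omega>\<^sup>2\<close>\<close>

abbreviation omega_omega :: "(nat \<Rightarrow> nat) rel" where
  "omega_omega \<equiv> ord_exp natLeq natLeq"

abbreviation omega_squared :: "(nat \<Rightarrow> nat) rel" where
  "omega_squared \<equiv> ord_exp natLeq (natLeq_on 2)"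

lemma natLeq_simps:
  "Field natLeq = UNIV" "underS natLeq n = {..<n}" "aboveS natLeq n = {n<..}"
  by (auto simp: underS_def aboveS_def natLeq_def Field_def)

lemma omega_omega_iff:
  "(f, g) \<in> omega_omega \<longleftrightarrow> finite {x. 0 < f x} \<and> finite {x. 0 < g x} \<and>
     (f = g \<or> (\<exists>x. f x < g x \<and> (\<forall>y>x. f y = g y)))"
  by (auto simp: ord_exp_def ord_exp_carrier_def natLeq_simps lessThan_empty_iff bot_nat_def)

lemma Field_omega_omega: "Field omega_omega = {f. finite {x. 0 < f x}}"
  unfolding Field_def Domain_iff Range_iff set_eq_iff Un_iff
  by (auto simp: omega_omega_iff)

lemma antisym_omega_omega: "antisym omega_omega"
proof (rule antisymI)
  fix f g assume fg: "(f, g) \<in> omega_omega" "(g, f) \<in> omega_omega"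
  show "f = g"
  proof (rule ccontr)
    assume "f \<noteq> g"
    with fg obtain x y where "f x < g x" "\<forall>z>x. f z = g z" "g y < f y" "\<forall>z>y. g z = f z"
      unfolding omega_omega_iff by metis
    then show False by (cases x y rule: linorder_cases) auto
  qed
qed

lemma trans_omega_omega: "trans omega_omega"
proof (rule transI)
  fix f g h assume fg: "(f, g) \<in> omega_omega" and gh: "(g, h) \<in> omega_omega"
  show "(f, h) \<in> omega_omega"
  proof (cases "f = g \<or> g = h")
    case True
    with fg gh show ?thesis by auto
  next
    case False
    with fg gh obtain x y where "f x < g x" "\<forall>z>x. f z = g z" "g y < h y" "\<forall>z>y. g z = h z"
      unfolding omega_omega_iff by metis
    then have "f (max x y) < h (max x y) \<and> (\<forall>z>max x y. f z = h z)"
      by (cases x y rule: linorder_cases) (auto simp: max_def)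
    with fg gh show ?thesis unfolding omega_omega_iff by blast
  qed
qed

text \<open>
  The ordinal \<open>\<omega> * i + j\<close> as an element of \<open>\<omega>\<^sup>2\<close>: the argument \<open>1\<close> is the leading one, and
  outside \<open>{0, 1}\<close> the functions in \<open>ord_exp_carrier\<close> are undefined.
\<close>
definition pair_code :: "nat \<times> nat \<Rightarrow> nat \<Rightarrow> nat" where
  "pair_code = (\<lambda>(i, j). (\<lambda>_. undefined)(0 := j, 1 := i))"

definition lex_less :: "nat \<times> nat \<Rightarrow> nat \<times> nat \<Rightarrow> bool" where
  "lex_less a b \<longleftrightarrow> fst a < fst b \<or> fst a = fst b \<and> snd a < snd b"

lemma less_2_iff: "(x::nat) < 2 \<longleftrightarrow> x = 0 \<or> x = 1" by auto

lemma pair_code_apply [simp]: "pair_code a 0 = snd a" "pair_code a 1 = fst a" "pair_code a (Suc 0) = fst a"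
  by (simp_all add: pair_code_def case_prod_unfold)

lemma Field_natLeq_on_2: "Field (natLeq_on 2) = {0, 1}"
  unfolding Field_natLeq_on by (auto simp: less_2_iff)

lemma ord_exp_carrier_2: "ord_exp_carrier natLeq (natLeq_on 2) = range pair_code"
proof -
  have "f \<in> range pair_code" if "f \<in> {0, 1} \<rightarrow>\<^sub>E (UNIV :: nat set)" for f
  proof (rule range_eqI)
    show "f = pair_code (f 1, f 0)"
      using that by (auto simp: pair_code_def fun_eq_iff PiE_def extensional_def)
  qed
  moreover have "pair_code a \<in> {0, 1} \<rightarrow>\<^sub>E UNIV" for a
    by (auto simp: pair_code_def PiE_def extensional_def case_prod_unfold)
  ultimately have "{0, 1} \<rightarrow>\<^sub>E UNIV = range pair_code"
    by (meson image_subset_iff subsetI subset_antisym)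
  then show ?thesis
    unfolding ord_exp_carrier_def Field_natLeq_on_2 natLeq_simps by simp
qed

lemma inj_pair_code: "inj pair_code"
  by (metis injI pair_code_apply prod.collapse)

lemma omega_squared_iff:
  "(f, g) \<in> omega_squared \<longleftrightarrow> (\<exists>a b. f = pair_code a \<and> g = pair_code b \<and> (a = b \<or> lex_less a b))"
proof -
  have above: "aboveS (natLeq_on 2) x = (if x = 0 then {1} else {})" if "x \<in> {0, 1}" for x
    using that by (auto simp: aboveS_def)
  have compare: "(\<exists>x \<in> {0, 1}. pair_code a x \<in> underS natLeq (pair_code b x) \<and>
      (\<forall>y \<in> aboveS (natLeq_on 2) x. pair_code a y = pair_code b y)) \<longleftrightarrow> lex_less a b" for a b
    by (auto simp: above lex_less_def natLeq_simps)
  have mem: "(f, g) \<in> omega_squared \<longleftrightarrow> f \<in> range pair_code \<and> g \<in> range pair_code \<and>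
      (f = g \<or> (\<exists>x \<in> {0, 1}. f x \<in> underS natLeq (g x) \<and>
         (\<forall>y \<in> aboveS (natLeq_on 2) x. f y = g y)))"
    unfolding ord_exp_def ord_exp_carrier_2 Field_natLeq_on_2 by simp
  show ?thesis
  proof (cases "f \<in> range pair_code \<and> g \<in> range pair_code")
    case True
    then obtain a b where fg: "f = pair_code a" "g = pair_code b" by blast
    show ?thesis unfolding mem unfolding fg compare by (auto simp: inj_eq[OF inj_pair_code])
  next
    case False
    then show ?thesis unfolding mem by blast
  qed
qed

lemma Field_omega_squared: "Field omega_squared = range pair_code"
proof
  show "Field omega_squared \<subseteq> range pair_code"
    by (auto simp: Field_def omega_squared_iff)
  show "range pair_code \<subseteq> Field omega_squared"
  proof
    fix f assume "f \<in> range pair_code"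
    then have "(f, f) \<in> omega_squared" by (auto simp: omega_squared_iff)
    then show "f \<in> Field omega_squared" by (rule FieldI1)
  qed
qed

lemma lex_less_linear: "a = b \<or> lex_less a b \<or> lex_less b a"
  by (cases a; cases b) (auto simp: lex_less_def)

lemma lex_less_asym: "lex_less a b \<Longrightarrow> \<not> lex_less b a" "\<not> lex_less a a"
  by (auto simp: lex_less_def)

lemma ex_lex_least:
  assumes "P a"
  shows "\<exists>m. P m \<and> (\<forall>b. lex_less b m \<longrightarrow> \<not> P b)"
proof -
  have "{(a, b). lex_less a b} = less_than <*lex*> less_than"
    by (auto simp: lex_less_def)
  then have "wf {(a, b). lex_less a b}" by (simp add: wf_lex_prod)
  then obtain m where "m \<in> {a. P a}" "\<And>b. (b, m) \<in> {(a, b). lex_less a b} \<Longrightarrow> b \<notin> {a. P a}"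
    by (rule wfE_min[of _ a "{a. P a}"]) (use assms in auto)
  then show ?thesis by (intro exI[of _ m]) simp
qed

lemma underS_omega_squared: "underS omega_squared (pair_code a) = pair_code ` {b. lex_less b a}"
  by (auto simp: underS_def omega_squared_iff inj_eq[OF inj_pair_code] lex_less_asym)

lemma aboveS_omega_squared: "aboveS omega_squared (pair_code a) = pair_code ` {b. lex_less a b}"
  by (auto simp: aboveS_def omega_squared_iff inj_eq[OF inj_pair_code] lex_less_asym)

lemma topspace_ord_topology: "topspace (ord_topology r) = Field r"
  by (auto simp: ord_topology_def underS_def aboveS_def Field_def)

lemma openin_rays:
  "a \<in> Field r \<Longrightarrow> openin (ord_topology r) (underS r a)"
  "a \<in> Field r \<Longrightarrow> openin (ord_topology r) (aboveS r a)"
  "openin (ord_topology r) (Field r)"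
  unfolding ord_topology_def by (auto intro!: topology_generated_by_Basis)

lemma continuous_map_ord_topology:
  assumes "f ` topspace T \<subseteq> Field r"
    and "\<And>b. b \<in> Field r \<Longrightarrow> openin T {x \<in> topspace T. f x \<in> underS r b}"
    and "\<And>b. b \<in> Field r \<Longrightarrow> openin T {x \<in> topspace T. f x \<in> aboveS r b}"
  shows "continuous_map T (ord_topology r) f"
  unfolding ord_topology_def
proof (rule continuous_on_generated_topo)
  fix U assume "U \<in> insert (Field r) (underS r ` Field r \<union> aboveS r ` Field r)"
  then consider "U = Field r" | b where "b \<in> Field r" "U = underS r b"
    | b where "b \<in> Field r" "U = aboveS r b" by blast
  then show "openin T (f -` U \<inter> topspace T)"
  proof cases
    case 1
    then have "f -` U \<inter> topspace T = topspace T" using assms(1) by auto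
    then show ?thesis by simp
  next
    case 2
    then show ?thesis using assms(2)[of b] by (simp add: vimage_def Int_def conj_commute)
  next
    case 3
    then show ?thesis using assms(3)[of b] by (simp add: vimage_def Int_def conj_commute)
  qed
qed (use assms(1) in blast)

text \<open>
  An initial segment of a well-order is everything or an open ray.
\<close>
lemma openin_omega_squared_initial:
  assumes "\<And>a b. P b \<Longrightarrow> lex_less a b \<Longrightarrow> P a"
  shows "openin (ord_topology omega_squared) (pair_code ` {a. P a})"
proof (cases "\<forall>a. P a")
  case True
  then have "{a. P a} = UNIV" by blast
  then show ?thesis using openin_rays(3)[of omega_squared] by (simp add: Field_omega_squared)
next
  case False
  then obtain m where "\<not> P m" "\<forall>b. lex_less b m \<longrightarrow> P b"
    using ex_lex_least[of "\<lambda>a. \<not> P a"] by blast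
  then have "P a \<longleftrightarrow> lex_less a m" for a
    using assms[of a m] assms[of m a] lex_less_linear[of a m] by blast
  then have "{a. P a} = {a. lex_less a m}" by blast
  then show ?thesis
    using openin_rays(1)[of "pair_code m" omega_squared]
    by (simp add: Field_omega_squared underS_omega_squared)
qed

text \<open>
  A final segment is open unless its least element is a limit, and the limits in \<open>\<omega>\<^sup>2\<close> are the
  elements \<open>(Suc i, 0)\<close>.
\<close>
lemma openin_omega_squared_final:
  assumes up: "\<And>a b. P a \<Longrightarrow> lex_less a b \<Longrightarrow> P b"
    and lim: "\<And>i. P (Suc i, 0) \<Longrightarrow> \<exists>j. P (i, j)"
  shows "openin (ord_topology omega_squared) (pair_code ` {a. P a})"
proof (cases "\<exists>a. P a")
  case False
  then have "{a. P a} = {}" by blast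
  then show ?thesis by (simp only: image_empty openin_empty)
next
  case True
  then obtain i j where m: "P (i, j)" "\<forall>b. lex_less b (i, j) \<longrightarrow> \<not> P b"
    using ex_lex_least[of P] by (metis surj_pair)
  show ?thesis
  proof (cases j)
    case (Suc j')
    have "P a \<longleftrightarrow> lex_less (i, j') a" for a
    proof -
      have "lex_less (i, j') a \<longleftrightarrow> a = (i, j) \<or> lex_less (i, j) a"
        by (cases a) (auto simp: lex_less_def Suc)
      then show ?thesis using m up[of "(i, j)" a] lex_less_linear[of a "(i, j)"] by blast
    qed
    then have "{a. P a} = {a. lex_less (i, j') a}" by blast
    then show ?thesis
      using openin_rays(2)[of "pair_code (i, j')" omega_squared]
      by (simp add: Field_omega_squared aboveS_omega_squared)
  next
    case 0
    have "i = 0"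
    proof (rule ccontr)
      assume "i \<noteq> 0"
      then obtain i' where "i = Suc i'" by (meson not0_implies_Suc)
      with lim[of i'] m 0 obtain j where "P (i', j)" by blast
      moreover have "lex_less (i', j) (i, 0)" using \<open>i = Suc i'\<close> by (simp add: lex_less_def)
      ultimately show False using m 0 by blast
    qed
    then have "P a" for a
      using m up[of "(0, 0)" a] 0 lex_less_linear[of a "(0, 0)"] by (auto simp: lex_less_def)
    then show ?thesis using openin_rays(3)[of omega_squared] by (simp add: Field_omega_squared)
  qed
qed

text \<open>
  A strictly increasing map is always open onto its image, because it carries rays to traces of
  rays. It is continuous if it preserves the suprema at the limits of \<open>\<omega>\<^sup>2\<close>.
\<close>
lemma closed_copy_omega_squared:
  fixes G :: "nat \<times> nat \<Rightarrow> 'a"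
  assumes "trans r" "antisym r" and field: "range G \<subseteq> Field r" and refl: "\<And>a. (G a, G a) \<in> r"
    and less: "\<And>a b. lex_less a b \<Longrightarrow> G a \<in> underS r (G b)"
    and lim: "\<And>i b. b \<in> underS r (G (Suc i, 0)) \<Longrightarrow> \<exists>j. b \<in> underS r (G (i, j))"
  shows "closed_copy r omega_squared (range G)"
proof -
  let ?X = "range G"
  have less_iff: "G a \<in> underS r (G b) \<longleftrightarrow> lex_less a b" for a b
    using less[of a b] less[of b a] lex_less_linear[of a b] \<open>antisym r\<close>
    by (auto simp: underS_def dest: antisymD)
  have above_iff: "G b \<in> aboveS r (G a) \<longleftrightarrow> lex_less a b" for a b
    using less_iff[of a b] by (auto simp: underS_def aboveS_def)
  have inj: "inj G"
    using less lex_less_linear by (metis (mono_tags, lifting) injI mem_Collect_eq underS_def)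
  define g where "g = G \<circ> inv pair_code"
  define h where "h = pair_code \<circ> inv G"
  have g: "g (pair_code a) = G a" for a
    by (simp add: g_def inv_f_f[OF inj_pair_code])
  have h: "h (G a) = pair_code a" for a
    by (simp add: h_def inv_f_f[OF inj])
  have under_trans: "x \<in> underS r c" if "x \<in> underS r b" "b \<in> underS r c" for x b c
    using that \<open>trans r\<close> \<open>antisym r\<close> by (auto simp: underS_def dest: transD antisymD)
  have Field: "Field (Restr r ?X) = ?X"
    using refl by (auto simp: Field_def)
  have "iso (Restr r ?X) omega_squared h"
    unfolding iso_iff2 Field
  proof (intro conjI ballI)
    show "bij_betw h ?X (Field omega_squared)"
      unfolding Field_omega_squared
      by (rule bij_betw_byWitness[of _ g]) (auto simp: g h)
    fix x y assume "x \<in> ?X" "y \<in> ?X"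
    then obtain a b where [simp]: "x = G a" "y = G b" by blast
    have "(G a, G b) \<in> r \<longleftrightarrow> a = b \<or> lex_less a b"
      using less_iff[of a b] refl[of a] inj_eq[OF inj, of a b] by (cases "a = b") (auto simp: underS_def)
    then show "(x, y) \<in> Restr r ?X \<longleftrightarrow> (h x, h y) \<in> omega_squared"
      by (auto simp: h omega_squared_iff inj_eq[OF inj_pair_code])
  qed
  moreover have "homeomorphic_maps (subtopology (ord_topology r) ?X) (ord_topology omega_squared) h g"
    unfolding homeomorphic_maps_def
  proof (intro conjI ballI)
    have space: "topspace (subtopology (ord_topology r) ?X) = ?X"
      using field by (simp add: topspace_ord_topology Int_absorb1)
    show "continuous_map (subtopology (ord_topology r) ?X) (ord_topology omega_squared) h"
    proof (rule continuous_map_ord_topology, unfold space Field_omega_squared)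
      show "h ` ?X \<subseteq> range pair_code" by (auto simp: h)
      fix b assume "b \<in> range pair_code"
      then obtain a where b: "b = pair_code a" by blast
      have a: "G a \<in> Field r" using field by blast
      have "{x \<in> ?X. h x \<in> underS omega_squared b} = underS r (G a) \<inter> ?X"
        by (auto simp: b underS_omega_squared h inj_eq[OF inj_pair_code] less_iff)
      then show "openin (subtopology (ord_topology r) ?X) {x \<in> ?X. h x \<in> underS omega_squared b}"
        using openin_rays(1)[OF a] by (auto simp: openin_subtopology)
      have "{x \<in> ?X. h x \<in> aboveS omega_squared b} = aboveS r (G a) \<inter> ?X"
        by (auto simp: b aboveS_omega_squared h inj_eq[OF inj_pair_code] above_iff)
      then show "openin (subtopology (ord_topology r) ?X) {x \<in> ?X. h x \<in> aboveS omega_squared b}"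
        using openin_rays(2)[OF a] by (auto simp: openin_subtopology)
    qed
    have "continuous_map (ord_topology omega_squared) (ord_topology r) g"
    proof (rule continuous_map_ord_topology, unfold topspace_ord_topology Field_omega_squared)
      show "g ` range pair_code \<subseteq> Field r" using field by (auto simp: g)
      fix b assume "b \<in> Field r"
      have "{x \<in> range pair_code. g x \<in> underS r b} = pair_code ` {a. G a \<in> underS r b}"
        by (auto simp: g)
      also have "openin (ord_topology omega_squared) \<dots>"
        by (rule openin_omega_squared_initial) (use under_trans less in blast)
      finally show "openin (ord_topology omega_squared) {x \<in> range pair_code. g x \<in> underS r b}" .
      have above: "x \<in> aboveS r b \<longleftrightarrow> b \<in> underS r x" for x
        by (auto simp: underS_def aboveS_def)
      have "{x \<in> range pair_code. g x \<in> aboveS r b} = pair_code ` {a. b \<in> underS r (G a)}"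
        by (auto simp: g above)
      also have "openin (ord_topology omega_squared) \<dots>"
        by (rule openin_omega_squared_final) (use under_trans less lim in blast)+
      finally show "openin (ord_topology omega_squared) {x \<in> range pair_code. g x \<in> aboveS r b}" .
    qed
    then show "continuous_map (ord_topology omega_squared) (subtopology (ord_topology r) ?X) g"
      by (auto simp: continuous_map_in_subtopology topspace_ord_topology Field_omega_squared g)
    show "g (h x) = x" if "x \<in> topspace (subtopology (ord_topology r) ?X)" for x
      using that by (auto simp: space g h)
    show "h (g y) = y" if "y \<in> topspace (ord_topology omega_squared)" for y
      using that by (auto simp: topspace_ord_topology Field_omega_squared g h)
  qed
  ultimately show ?thesis
    unfolding closed_copy_def using field homeomorphic_maps_imp_map by blast
qed

section \<open>Nodes as ordinals below \<open>\<omega>\<^sup>\<omega>\<close>\<close>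

text \<open>
  The ordinal \<open>\<omega>\<^sup>N\<^sup>-\<^sup>1 a\<^sub>1 + \<dots> + \<omega>\<^sup>N\<^sup>-\<^sup>m (a\<^sub>m + 1)\<close> for \<open>xs = [a\<^sub>1, \<dots>, a\<^sub>m]\<close>, given by its
  coefficients. With the additional one, this ordinal is the limit of the codes of \<open>xs @ [a]\<close> for
  \<open>a\<close> tending to infinity.
\<close>
definition code :: "nat \<Rightarrow> nat list \<Rightarrow> nat \<Rightarrow> nat" where
  "code N xs n =
     (if n < N then nth_default 0 xs (N - Suc n) else 0) + of_bool (n = N - length xs)"

lemma code_in_Field:
  assumes "xs \<noteq> []" "length xs \<le> N"
  shows "code N xs \<in> Field omega_omega"
proof -
  have "{n. 0 < code N xs n} \<subseteq> {..N}" by (auto simp: code_def)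
  then show ?thesis unfolding Field_omega_omega by (simp add: finite_subset)
qed

text \<open>
  The lowest nonzero coefficient is at least one, by the additional one, and its position
  determines the length of the list.
\<close>
lemma code_inj:
  assumes "xs \<noteq> []" "length xs \<le> N" "ys \<noteq> []" "length ys \<le> N" "code N xs = code N ys"
  shows "xs = ys"
proof -
  have *: False if "length ys < length xs" "ys \<noteq> []" "length xs \<le> N" "code N xs = code N ys" for xs ys
  proof -
    have "N - length xs \<noteq> N - length ys" "N - length xs < N" using that by auto
    then show False using fun_cong[OF that(4), of "N - length xs"] that(1-3)
      by (simp add: code_def nth_default_beyond)
  qed
  have len: "length xs = length ys"
    using *[of xs ys] *[of ys xs] assms by (metis linorder_neqE_nat)
  show ?thesis
  proof (rule nth_equalityI[OF len])
    fix i assume "i < length xs"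
    then have "N - Suc i < N" "N - Suc (N - Suc i) = i" using assms(2) by auto
    then show "xs ! i = ys ! i"
      using fun_cong[OF assms(5), of "N - Suc i"] \<open>i < length xs\<close> len
      by (simp add: code_def nth_default_nth)
  qed
qed

text \<open>
  The entry with index \<open>i\<close> is the digit at position \<open>N - Suc i\<close>, so that lists with the common
  prefix \<open>s\<close> have the same digits above the position \<open>N - Suc (length s)\<close>.
\<close>
lemma code_above:
  assumes "length (s @ a # u) \<le> N" "length (s @ b # v) \<le> N" "N - Suc (length s) < m"
  shows "code N (s @ a # u) m = code N (s @ b # v) m"
proof (cases "m < N")
  case True
  then have "N - Suc m < length s" using assms by auto
  moreover have "m \<noteq> N - length (s @ a # u)" "m \<noteq> N - length (s @ b # v)" using assms by auto
  ultimately show ?thesis by (simp add: code_def nth_default_append)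
next
  case False
  then show ?thesis using assms by (auto simp: code_def)
qed

lemma code_digit:
  assumes "length (s @ a # u) \<le> N"
  shows "code N (s @ a # u) (N - Suc (length s)) = a + of_bool (u = [])"
proof -
  have "N - Suc (length s) < N" "N - Suc (N - Suc (length s)) = length s" using assms by auto
  moreover have "N - Suc (length s) = N - length (s @ a # u) \<longleftrightarrow> u = []"
    using assms by (cases u) auto
  ultimately show ?thesis by (simp add: code_def nth_default_append)
qed

lemma code_below:
  assumes "length s < N" "m < N - Suc (length s)"
  shows "code N (s @ [a]) m = 0"
  using assms by (auto simp: code_def nth_default_beyond)

lemma underS_omega_omega:
  assumes "f \<in> Field omega_omega" "g \<in> Field omega_omega" "f x < g x" "\<And>y. y > x \<Longrightarrow> f y = g y"
  shows "f \<in> underS omega_omega g"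
  using assms unfolding underS_def omega_omega_iff Field_omega_omega by auto

lemma code_less_digit:
  assumes "length (s @ a # u) \<le> N" "length (s @ b # v) \<le> N"
    and "a + of_bool (u = []) < b + of_bool (v = [])"
  shows "code N (s @ a # u) \<in> underS omega_omega (code N (s @ b # v))"
  using assms
  by (intro underS_omega_omega[of _ _ "N - Suc (length s)"] code_in_Field)
    (auto simp: code_digit intro!: code_above)

text \<open>
  If the last digit of the first node, increased by one, is the corresponding digit of the second
  node, then the second node is larger by its next digit.
\<close>
lemma code_limit_less:
  assumes "length (s @ Suc a # b # v) \<le> N" "0 < b"
  shows "code N (s @ [a]) \<in> underS omega_omega (code N (s @ Suc a # b # v))"
proof (rule underS_omega_omega[of _ _ "N - Suc (length (s @ [Suc a]))"])
  show "code N (s @ [a]) (N - Suc (length (s @ [Suc a]))) <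
      code N (s @ Suc a # b # v) (N - Suc (length (s @ [Suc a])))"
    using code_digit[of "s @ [Suc a]" b v N] code_below[of s N "N - Suc (length (s @ [Suc a]))" a] assms
    by simp
  show "code N (s @ [a]) y = code N (s @ Suc a # b # v) y"
    if "y > N - Suc (length (s @ [Suc a]))" for y
  proof (cases "y = N - Suc (length s)")
    case True
    then show ?thesis
      using code_digit[of s a "[]" N] code_digit[of s "Suc a" "b # v" N] assms by simp
  next
    case False
    with that assms have "N - Suc (length s) < y" by auto
    then show ?thesis using assms by (intro code_above) auto
  qed
qed (use assms in \<open>auto intro!: code_in_Field\<close>)

text \<open>
  A function below \<open>code N (s @ [a])\<close> either falls short at a position where all the extensions
  of \<open>s @ [a]\<close> have the same digits, or it agrees with these and is exceeded at the next position
  once \<open>c j\<close> is large.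
\<close>
lemma code_limit:
  fixes c :: "nat \<Rightarrow> nat" and w :: "nat \<Rightarrow> nat list"
  assumes N: "\<And>j. length (s @ a # c j # w j) \<le> N" and c: "strict_mono c"
    and f: "f \<in> underS omega_omega (code N (s @ [a]))"
  shows "\<exists>j. f \<in> underS omega_omega (code N (s @ a # c j # w j))"
proof -
  let ?n = "N - Suc (length s)"
  have len: "Suc (Suc (length s)) \<le> N" using N[of 0] by simp
  obtain x where x: "f x < code N (s @ [a]) x" "\<And>y. y > x \<Longrightarrow> f y = code N (s @ [a]) y"
    and field: "f \<in> Field omega_omega"
    using f unfolding underS_def omega_omega_iff Field_omega_omega by auto
  have above: "code N (s @ [a]) y = code N (s @ a # c j # w j) y" if "?n < y" for y j
    using that N[of j] by (intro code_above) auto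
  have x_ge: "?n \<le> x"
    using x(1) code_below[of s N x a] len by (metis Suc_le_lessD less_nat_zero_code not_le_imp_less Suc_leD)
  show ?thesis
  proof (cases "?n < x \<or> f ?n < a")
    case True
    have "f \<in> underS omega_omega (code N (s @ a # c 0 # w 0))"
    proof (cases "?n < x")
      case True
      then show ?thesis
        using x above N[of 0] by (intro underS_omega_omega[of _ _ x] field code_in_Field) auto
    next
      case False
      with True x_ge have "f ?n < a" "x = ?n" by auto
      then show ?thesis
        using x above[of _ 0] N[of 0] code_digit[of s a "c 0 # w 0" N]
        by (intro underS_omega_omega[of _ _ x] field code_in_Field) auto
    qed
    then show ?thesis ..
  next
    case False
    with x_ge have "x = ?n" by simp
    with False x(1) code_digit[of s a "[]" N] len have eq: "f ?n = a" by simp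
    let ?m = "N - Suc (length (s @ [a]))"
    define j where "j = Suc (f ?m)"
    have "f ?m < c j" using strict_mono_imp_increasing[OF c, of j] by (simp add: j_def)
    have "f \<in> underS omega_omega (code N (s @ a # c j # w j))"
    proof (rule underS_omega_omega[of _ _ ?m])
      show "f ?m < code N (s @ a # c j # w j) ?m"
        using \<open>f ?m < c j\<close> code_digit[of "s @ [a]" "c j" "w j" N] N[of j] by simp
      show "f y = code N (s @ a # c j # w j) y" if "y > ?m" for y
      proof (cases "y = ?n")
        case True
        then show ?thesis using eq code_digit[of s a "c j # w j" N] N[of j] by simp
      next
        case False
        with that len have "?n < y" by auto
        then show ?thesis using x(2)[of y] above \<open>x = ?n\<close> by simp
      qed
    qed (use field N[of j] in \<open>auto intro!: code_in_Field\<close>)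
    then show ?thesis ..
  qed
qed

text \<open>
  The points are enumerated in the order type \<open>\<omega>\<^sup>2\<close> by letting \<open>y\<^sub>i\<close> be the element with index
  \<open>(Suc i, 0)\<close>, as it is the limit of the \<open>x\<^sub>i\<^sub>j\<close>, which have the indices \<open>(i, j)\<close>. The points
  \<open>x\<^sub>i\<^sub>0\<close> with \<open>i > 0\<close> are left out for this purpose.
\<close>
lemma closed_copy_tree:
  assumes "convergent_tree N s h c w"
  shows "\<exists>X \<subseteq> code N ` tree_nodes s h c w. closed_copy omega_omega omega_squared X"
proof -
  have N: "\<And>i j. length (s @ h i # c i j # w i j) \<le> N"
    and h: "strict_mono h" and c: "\<And>i. strict_mono (c i)" "\<And>i j. 0 < c i j"
    and w: "\<And>i j j'. w i j = [] \<longleftrightarrow> w i j' = []"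
    using assms unfolding convergent_tree_def by blast+
  define G where "G = (\<lambda>(i, j). code N (case (i, j) of
    (Suc i', 0) \<Rightarrow> s @ [h i'] | _ \<Rightarrow> s @ h i # c i j # w i j))"
  have len: "Suc (length s) \<le> N" using N[of 0 0] by simp
  have G: "G (Suc i, 0) = code N (s @ [h i])"
    "j \<noteq> 0 \<or> i = 0 \<Longrightarrow> G (i, j) = code N (s @ h i # c i j # w i j)" for i j
    by (auto simp: G_def split: nat.splits)
  have cases: "(\<exists>i'. i = Suc i' \<and> j = 0) \<or> (j \<noteq> 0 \<or> i = 0)" for i j :: nat
    by (cases i) auto
  have G_range: "G a \<in> code N ` tree_nodes s h c w" for a
  proof -
    have "s @ [h i] \<in> tree_nodes s h c w" "s @ h i # c i j # w i j \<in> tree_nodes s h c w" for i j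
      by (auto simp: tree_nodes_def)
    then show ?thesis using cases[of "fst a" "snd a"] G by (cases a) auto
  qed
  have G_field: "G a \<in> Field omega_omega" for a
    using cases[of "fst a" "snd a"] G N len by (cases a) (auto intro!: code_in_Field)
  have below_limit: "code N (s @ [h i]) \<in> underS omega_omega (code N (s @ h i' # c i' j # w i' j))"
    if "i < i'" for i i' j
  proof (cases "h i' = Suc (h i)")
    case True
    then show ?thesis using code_limit_less[of s "h i" "c i' j" "w i' j" N] N[of i' j] c(2) by simp
  next
    case False
    moreover have "h i < h i'" using h that by (rule strict_monoD)
    ultimately show ?thesis using N[of i' j] len by (intro code_less_digit) auto
  qed
  have "closed_copy omega_omega omega_squared (range G)"
  proof (rule closed_copy_omega_squared[OF trans_omega_omega antisym_omega_omega])
    show "range G \<subseteq> Field omega_omega" using G_field by blast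
    show "(G a, G a) \<in> omega_omega" for a
      using G_field[of a] unfolding omega_omega_iff Field_omega_omega by simp
    show "G a \<in> underS omega_omega (G b)" if "lex_less a b" for a b
    proof -
      obtain i j i' j' where ab: "a = (i, j)" "b = (i', j')" by fastforce
      with that have less: "i < i' \<or> i = i' \<and> j < j'" by (simp add: lex_less_def)
      consider (xx) "j \<noteq> 0 \<or> i = 0" "j' \<noteq> 0 \<or> i' = 0" | (yy) k k' where "i = Suc k" "j = 0" "i' = Suc k'" "j' = 0"
        | (xy) k' where "j \<noteq> 0 \<or> i = 0" "i' = Suc k'" "j' = 0" | (yx) k where "i = Suc k" "j = 0" "j' \<noteq> 0 \<or> i' = 0"
        using cases[of i j] cases[of i' j'] by blast
      then show ?thesis
      proof cases
        case xx
        show ?thesis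
        proof (cases "i = i'")
          case True
          with less have "c i j < c i j'" using c(1) by (auto dest: strict_monoD)
          then have "code N ((s @ [h i]) @ c i j # w i j) \<in> underS omega_omega (code N ((s @ [h i]) @ c i j' # w i j'))"
            using N[of i j] N[of i j'] w[of i j j'] by (intro code_less_digit) auto
          then show ?thesis using xx True by (simp add: ab G)
        next
          case False
          with less h have "h i < h i'" by (auto dest: strict_monoD)
          then show ?thesis using xx N[of i j] N[of i' j'] by (simp add: ab G code_less_digit)
        qed
      next
        case yy
        with less h have "h k < h k'" by (auto dest: strict_monoD)
        then show ?thesis using yy len by (simp add: ab G code_less_digit)
      next
        case xy
        with less have "i \<le> k'" by auto
        then have "h i \<le> h k'" using h by (simp add: strict_mono_less_eq)
        then show ?thesis using xy len N[of i j] by (simp add: ab G code_less_digit)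
      next
        case yx
        with less have "k < i'" by auto
        then show ?thesis using yx below_limit by (simp add: ab G)
      qed
    qed
    show "\<exists>j. f \<in> underS omega_omega (G (i, j))" if "f \<in> underS omega_omega (G (Suc i, 0))" for i f
    proof -
      have "strict_mono (\<lambda>j. c i (Suc j))" using c(1)[of i] by (simp add: strict_mono_def)
      then have "\<exists>j. f \<in> underS omega_omega (code N (s @ h i # c i (Suc j) # w i (Suc j)))"
        using that N by (intro code_limit[where c = "\<lambda>j. c i (Suc j)" and w = "\<lambda>j. w i (Suc j)"])
          (simp_all only: G)
      then obtain j where "f \<in> underS omega_omega (code N (s @ h i # c i (Suc j) # w i (Suc j)))" ..
      then show ?thesis using G(2)[of "Suc j" i] by (intro exI[of _ "Suc j"]) simp
    qed
  qed
  then show ?thesis using G_range by (intro exI[of _ "range G"]) blast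
qed

section \<open>The partition relation\<close>

theorem theorem7p1:
  fixes k :: nat
  assumes "k > 0"
  shows "cl_arrow (ord_exp natLeq natLeq) (ord_exp natLeq (natLeq_on 2)) k"
proof -
  obtain N where N: "partn_lst {..<N::nat} [k, k, k, k, 2] 2" using ramsey_full by blast
  show ?thesis
    unfolding cl_arrow_def
  proof
    fix col :: "(nat \<Rightarrow> nat) set \<Rightarrow> colour"
    obtain \<theta> where \<theta>: "strict_mono \<theta>"
      and inv: "order_invariant (2 * N)
        (\<lambda>A B. col {code N (map \<theta> A), code N (map \<theta> B)} = Blue)"
      using ex_order_invariant_subsequence[of "2 * N" "\<lambda>A B. col {code N A, code N B} = Blue"]
      by blast
    define F where "F A B \<longleftrightarrow> col {code N (map \<theta> A), code N (map \<theta> B)} = Blue" for A B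
    have F: "order_invariant (2 * N) F" "symp F"
      using inv by (simp_all add: F_def[abs_def] symp_def insert_commute)
    show "(\<exists>X. closed_copy omega_omega omega_squared X \<and> (\<forall>e \<in> [X]\<^bsup>2\<^esup>. col e = Red)) \<or>
          (\<exists>Y \<in> [Field omega_omega]\<^bsup>k\<^esup>. \<forall>e \<in> [Y]\<^bsup>2\<^esup>. col e = Blue)"
    proof (cases "has_clique N k F")
      case True
      then obtain Z where Z: "Z \<subseteq> nodes N" "finite Z" "card Z = k"
        "\<And>A B. A \<in> Z \<Longrightarrow> B \<in> Z \<Longrightarrow> A \<noteq> B \<Longrightarrow> F A B"
        unfolding has_clique_def by blast
      let ?Y = "(\<lambda>A. code N (map \<theta> A)) ` Z"
      have "inj_on (\<lambda>A. code N (map \<theta> A)) Z"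
      proof (rule inj_onI)
        fix A B assume "A \<in> Z" "B \<in> Z" "code N (map \<theta> A) = code N (map \<theta> B)"
        then have "map \<theta> A = map \<theta> B"
          using Z(1) by (intro code_inj[of _ N]) (auto simp: nodes_def)
        then show "A = B" using strict_mono_imp_inj_on[OF \<theta>] by (simp add: inj_map_eq_map)
      qed
      then have "?Y \<in> [Field omega_omega]\<^bsup>k\<^esup>"
        using Z by (auto simp: nsets_def card_image nodes_def intro!: code_in_Field)
      moreover have "\<forall>e \<in> [?Y]\<^bsup>2\<^esup>. col e = Blue"
      proof
        fix e assume "e \<in> [?Y]\<^bsup>2\<^esup>"
        then obtain A B where "A \<in> Z" "B \<in> Z" "A \<noteq> B" "e = {code N (map \<theta> A), code N (map \<theta> B)}"
          unfolding nsets_2_eq by blast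
        then show "col e = Blue" using Z(4) unfolding F_def by blast
      qed
      ultimately show ?thesis by blast
    next
      case False
      from ex_unattained_tree[OF F False N order_refl] obtain s h c w
        where tree: "convergent_tree N s h c w"
          and red: "\<forall>A \<in> tree_nodes s h c w. \<forall>B \<in> tree_nodes s h c w. A \<noteq> B \<longrightarrow> \<not> F A B"
        by blast
      from closed_copy_tree[OF convergent_tree_map[OF \<theta> tree]] obtain X
        where "X \<subseteq> code N ` map \<theta> ` tree_nodes s h c w"
          and X: "closed_copy omega_omega omega_squared X"
        unfolding tree_nodes_map by blast
      then have sub: "X \<subseteq> (\<lambda>A. code N (map \<theta> A)) ` tree_nodes s h c w" by (simp add: image_image)
      have "col e = Red" if e: "e \<in> [X]\<^bsup>2\<^esup>" for e
      proof -
        obtain u v where uv: "u \<in> X" "v \<in> X" "u \<noteq> v" "e = {u, v}"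
          using e unfolding nsets_2_eq by blast
        obtain A B where AB: "A \<in> tree_nodes s h c w" "B \<in> tree_nodes s h c w" "u = code N (map \<theta> A)" "v = code N (map \<theta> B)"
          using sub uv(1,2) by (meson imageE subsetD)
        with uv(3) have "A \<noteq> B" by blast
        with red AB(1,2) have "\<not> F A B" by blast
        then have "col e \<noteq> Blue" unfolding F_def AB(3,4)[symmetric] uv(4) .
        then show ?thesis by (cases "col e") auto
      qed
      with X show ?thesis by blast
    qed
  qed
qed

end
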